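(* Let $m\ge1$ be an integer, let $\lambda\in(0,1]$ and $\lambda_k\in(0,1]$, let $f_k\in\mathcal{U}(\lambda_k)$ for $k=1,\ldots,m$, and suppose that $\sum_{k=1}^m\frac{z}{f_k(z)}\neq0$ for all $z\in\mathbb{D}$ (each $z/f_k(z)$ being taken as $1$ at $z=0$). Define $F$ on $\mathbb{D}$ by $$\frac{z}{F(z)}=\frac1m\sum_{k=1}^m\frac{z}{f_k(z)}$$ (with $F(0)=0$). Then $G$ defined by $G(z)=r^{-1}F(rz)$ belongs to $\mathcal{U}(\lambda)$ whenever $$0<r\le\sqrt{\frac{-K^2+K\sqrt{K^2+4}}{2}}\quad\text{with}\quad K=\sqrt{\frac{m\lambda^2}{\sum_{k=1}^m\lambda_k}}.$$ In particular, if $f_k\in\mathcal{U}$ for $k=1,\ldots,m$, then $G\in\mathcal{U}$ for $0<r\le\sqrt{\frac{\sqrt5-1}{2}}$; that is, $F$ is univalent in the disk $|z|<\sqrt{\frac{\sqrt5-1}{2}}$.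
   Context: $\mathbb{D}=\{z\in\mathbb{C}:|z|<1\}$. $\mathcal{A}$ is the class of functions $f$ analytic in $\mathbb{D}$ with $f(0)=0$, $f'(0)=1$. For $\lambda\in(0,1]$, $\mathcal{U}(\lambda)$ is the set of $f\in\mathcal{A}$ (with $f(z)/z\ne0$ in $\mathbb{D}$) satisfying $$\left|f'(z)\left(\frac{z}{f(z)}\right)^2-1\right|<\lambda\quad\text{for all } z\in\mathbb{D},$$ where $z/f(z)$ is taken to be $1$ at $z=0$; and $\mathcal{U}:=\mathcal{U}(1)$. Functions in $\mathcal{U}$ are known to be univalent (injective) in $\mathbb{D}$. *)

theory Defs
  imports "HOL-Complex_Analysis.Complex_Analysis"
begin

definition class_A :: "(complex \<Rightarrow> complex) set" where
  "class_A = {f. f holomorphic_on ball 0 1 \<and> f 0 = 0 \<and> deriv f 0 = 1}"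

definition z_over :: "(complex \<Rightarrow> complex) \<Rightarrow> complex \<Rightarrow> complex" where
  "z_over f z = (if z = 0 then 1 else z / f z)"

(* The condition f z / z \<noteq> 0 at the origin is f'(0) = 1 \<noteq> 0, so only z \<noteq> 0 is listed. *)
definition class_U :: "real \<Rightarrow> (complex \<Rightarrow> complex) set" where
  "class_U l = {f \<in> class_A.
     (\<forall>z\<in>ball 0 1 - {0}. f z / z \<noteq> 0) \<and>
     (\<forall>z\<in>ball 0 1. norm (deriv f z * (z_over f z)\<^sup>2 - 1) < l)}"

end

theory Submission
  imports Defs
begin

text \<open>
  Write \<open>p z = z / f z\<close>. The quotient rule turns the quantity \<open>f' (z / f)\<^sup>2\<close>, which is nonlinear
  in \<open>f\<close>, into \<open>p - z p'\<close>, which is linear in \<open>p\<close> (\<open>class_U_iff_z_over\<close>). Averaging the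
  functions \<open>z / f\<^sub>k\<close> therefore averages the defects \<open>p\<^sub>k - z p\<^sub>k' - 1\<close>, and \<open>F\<close> belongs to
  \<open>class_U L\<close> with \<open>L\<close> the mean of the \<open>\<lambda>\<^sub>k\<close>.

  The defect \<open>p - z p' - 1\<close> has no constant and no linear Taylor coefficient at the origin, so
  the Schwarz lemma, used twice, improves the bound \<open>L\<close> to \<open>L \<bar>z\<bar>\<^sup>2\<close>. Replacing \<open>F z\<close> by
  \<open>F (r z) / r\<close> replaces the defect at \<open>z\<close> by the defect at \<open>r z\<close>, so the dilated function is in
  \<open>class_U \<lambda>\<close> as soon as \<open>r \<le> 1\<close> and \<open>L r\<^sup>2 \<le> \<lambda>\<close>. The radius in the theorem makes \<open>r\<^sup>2\<close> at most the positive root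
  of \<open>x\<^sup>2 = K\<^sup>2 (1 - x)\<close> with \<open>K\<^sup>2 = \<lambda>\<^sup>2 / L\<close>; hence \<open>(L r\<^sup>2)\<^sup>2 \<le> L \<lambda>\<^sup>2 (1 - r\<^sup>2) \<le> \<lambda>\<^sup>2\<close>, because
  \<open>L \<le> 1\<close>.

  For univalence of \<open>f\<close> in \<open>class_U 1\<close>, the function \<open>g z = 1 / f z - 1 / z\<close>
  extends over the origin and its derivative is minus
  the defect divided by \<open>z\<^sup>2\<close>, hence bounded by \<open>1\<close>. If \<open>f z = f w\<close>, then
  \<open>\<bar>z - w\<bar> / \<bar>z w\<bar> = \<bar>g z - g w\<bar> \<le> \<bar>z - w\<bar>\<close>, which forces \<open>z = w\<close> as \<open>\<bar>z w\<bar> < 1\<close>.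
\<close>

section \<open>A second-order Schwarz lemma\<close>

text \<open>If \<open>u\<close> vanishes to second order, then \<open>u z / z\<close> again satisfies the hypotheses of the
  Schwarz lemma. The strict bound \<open>\<bar>u z / z\<bar> < M\<close> holds because equality would make \<open>u\<close> a nonzero
  multiple of the identity, against \<open>u' 0 = 0\<close>.\<close>

lemma Schwarz_Lemma_second_order:
  assumes hol: "u holomorphic_on ball 0 1"
    and u0: "u 0 = 0" and du0: "deriv u 0 = 0"
    and bound: "\<And>z. norm z < 1 \<Longrightarrow> norm (u z) < M"
    and z: "norm z < 1"
  shows "norm (u z) \<le> M * (norm z)\<^sup>2"
proof -
  have M: "M > 0"
    using bound[of 0] u0 by simp
  define w where "w = (\<lambda>z. u z / of_real M)"
  have holw: "w holomorphic_on ball 0 1"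
    unfolding w_def using M by (intro holomorphic_intros hol) auto
  have w0: "w 0 = 0"
    by (simp add: w_def u0)
  have w_less: "norm (w z) < 1" if "norm z < 1" for z
    using bound[OF that] M by (simp add: w_def norm_divide)
  have "(w has_field_derivative deriv u 0 / of_real M) (at 0)"
    unfolding w_def by (intro DERIV_cdivide holomorphic_derivI[OF hol open_ball]) simp
  then have dw0: "deriv w 0 = 0"
    by (simp add: DERIV_imp_deriv du0)
  obtain h where holh: "h holomorphic_on ball 0 1"
    and wh: "\<And>z. norm z < 1 \<Longrightarrow> w z = z * h z" and dh: "deriv w 0 = h 0"
    using Schwarz3[OF holw w0] by blast
  have h_less: "norm (h z) < 1" if z: "norm z < 1" for z
  proof (cases "z = 0")
    case True
    then show ?thesis using dh dw0 by simp
  next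
    case False
    have "norm (w z) \<noteq> norm z"
    proof
      assume "norm (w z) = norm z"
      then obtain \<alpha> where \<alpha>: "\<And>z. norm z < 1 \<Longrightarrow> w z = \<alpha> * z" and "norm \<alpha> = 1"
        using Schwarz_Lemma(3)[OF holw w0 w_less z] z False by blast
      have "(w has_field_derivative \<alpha>) (at 0)"
        by (rule has_field_derivative_transform_within_open
              [where f = "\<lambda>z. \<alpha> * z" and S = "ball 0 1"])
           (auto intro!: derivative_eq_intros simp: \<alpha>)
      then show False
        using dw0 \<open>norm \<alpha> = 1\<close> by (auto dest: DERIV_imp_deriv)
    qed
    with Schwarz_Lemma(1)[OF holw w0 w_less z] have "norm (w z) < norm z"
      by simp
    then show ?thesis
      using False by (simp add: wh[OF z] norm_mult)
  qed
  have "norm (h z) \<le> norm z"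
    using Schwarz_Lemma(1)[OF holh _ h_less z] dh dw0 by simp
  then have "norm (w z) \<le> (norm z)\<^sup>2"
    by (simp add: wh[OF z] norm_mult power2_eq_square mult_left_mono)
  then show ?thesis
    using M by (simp add: w_def norm_divide field_simps)
qed

section \<open>The class in terms of the quotient \<open>z / f z\<close>\<close>

lemma holomorphic_z_over:
  assumes "f \<in> class_A" and nz: "\<And>z. z \<in> ball 0 1 - {0} \<Longrightarrow> f z \<noteq> 0"
  shows "z_over f holomorphic_on ball 0 1"
proof -
  have hol: "f holomorphic_on ball 0 1" and f0: "f 0 = 0" and df0: "deriv f 0 = 1"
    using assms(1) by (auto simp: class_A_def)
  define h where "h = (\<lambda>z. if z = 0 then deriv f 0 else (f z - f 0) / (z - 0))"
  have "h holomorphic_on ball 0 1"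
    unfolding h_def by (rule pole_lemma[OF hol]) simp
  moreover have "h z \<noteq> 0" if "z \<in> ball 0 1" for z
    using nz[of z] that by (auto simp: h_def f0 df0)
  ultimately have "(\<lambda>z. 1 / h z) holomorphic_on ball 0 1"
    by (intro holomorphic_intros)
  then show ?thesis
    by (rule holomorphic_transform) (simp add: h_def z_over_def f0 df0)
qed

lemma z_over_quotient_derivative:
  assumes hol: "z_over f holomorphic_on ball 0 1" and f0: "f 0 = 0"
    and nz: "\<And>z. z \<in> ball 0 1 \<Longrightarrow> z_over f z \<noteq> 0" and z: "z \<in> ball 0 1"
  shows "(f has_field_derivative (z_over f z - z * deriv (z_over f) z) / (z_over f z)\<^sup>2) (at z)"
proof (rule has_field_derivative_transform_within_open)
  show "((\<lambda>z. z / z_over f z) has_field_derivative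
          (z_over f z - z * deriv (z_over f) z) / (z_over f z)\<^sup>2) (at z)"
    using holomorphic_derivI[OF hol _ z] nz[OF z]
    by (auto intro!: derivative_eq_intros simp: power2_eq_square)
  show "x / z_over f x = f x" if "x \<in> ball 0 1" for x
    using nz[OF that] f0 by (auto simp: z_over_def)
qed (use z in auto)

text \<open>The description of the class that is used from here on: in terms of \<open>z / f\<close> the defining
  inequality bounds an affine expression.\<close>

lemma class_U_iff_z_over:
  "f \<in> class_U l \<longleftrightarrow>
     f 0 = 0 \<and> z_over f holomorphic_on ball 0 1 \<and>
     (\<forall>z\<in>ball 0 1. z_over f z \<noteq> 0 \<and>
        norm (z_over f z - z * deriv (z_over f) z - 1) < l)"
  (is "_ \<longleftrightarrow> ?R")
proof -
  have defect: "deriv f z * (z_over f z)\<^sup>2 = z_over f z - z * deriv (z_over f) z"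
    if "f 0 = 0" "z_over f holomorphic_on ball 0 1" "\<forall>z\<in>ball 0 1. z_over f z \<noteq> 0"
      "z \<in> ball 0 1" for z
    using DERIV_imp_deriv[OF z_over_quotient_derivative[of f z]] that by auto
  show ?thesis
  proof
    assume f: "f \<in> class_U l"
    have f0: "f 0 = 0" and nz: "\<And>z. z \<in> ball 0 1 - {0} \<Longrightarrow> f z \<noteq> 0"
      using f by (auto simp: class_U_def class_A_def)
    have hol: "z_over f holomorphic_on ball 0 1"
      using f nz by (intro holomorphic_z_over) (auto simp: class_U_def)
    have pnz: "\<forall>z\<in>ball 0 1. z_over f z \<noteq> 0"
      using nz by (auto simp: z_over_def)
    show ?R
      using f f0 hol pnz defect[OF f0 hol pnz] by (auto simp: class_U_def)
  next
    assume R: ?R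
    have der: "(f has_field_derivative
        (z_over f z - z * deriv (z_over f) z) / (z_over f z)\<^sup>2) (at z)" if "z \<in> ball 0 1" for z
      using R that by (intro z_over_quotient_derivative) auto
    have "f holomorphic_on ball 0 1"
      using der by (meson holomorphic_on_open open_ball)
    moreover have "deriv f 0 = 1"
      using DERIV_imp_deriv[OF der[of 0]] by (simp add: z_over_def)
    moreover have "f z \<noteq> 0" if "z \<in> ball 0 1 - {0}" for z
    proof -
      have "z_over f z \<noteq> 0" "z \<noteq> 0"
        using R that by auto
      then show ?thesis
        by (auto simp: z_over_def)
    qed
    ultimately show "f \<in> class_U l"
      using R defect unfolding class_U_def class_A_def by simp
  qed
qed

lemma class_U_imp_pos:
  assumes "f \<in> class_U l"
  shows "l > 0"
proof -
  have "norm (z_over f 0 - 0 * deriv (z_over f) 0 - 1) < l"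
    using assms unfolding class_U_iff_z_over by (metis centre_in_ball zero_less_one)
  then show ?thesis
    by (simp add: z_over_def)
qed

text \<open>With \<open>p = 1 + b\<^sub>1 z + b\<^sub>2 z\<^sup>2 + \<dots>\<close> the defect is \<open>- b\<^sub>2 z\<^sup>2 - 2 b\<^sub>3 z\<^sup>3 - \<dots>\<close>, so it
  vanishes to second order.\<close>

lemma class_U_defect_bound:
  assumes f: "f \<in> class_U l" and z: "z \<in> ball 0 1"
  shows "norm (z_over f z - z * deriv (z_over f) z - 1) \<le> l * (norm z)\<^sup>2"
proof -
  let ?p = "z_over f"
  have hol: "?p holomorphic_on ball 0 1"
    using f by (simp add: class_U_iff_z_over)
  then have hol': "deriv ?p holomorphic_on ball 0 1"
    by (intro holomorphic_deriv) auto
  have "((\<lambda>z. ?p z - z * deriv ?p z - 1) has_field_derivative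
          deriv ?p 0 - (deriv ?p 0 + 0 * deriv (deriv ?p) 0) - 0) (at 0)"
    using holomorphic_derivI[OF hol open_ball, of 0] holomorphic_derivI[OF hol' open_ball, of 0]
    by (auto intro!: derivative_eq_intros)
  then have "deriv (\<lambda>z. ?p z - z * deriv ?p z - 1) 0 = 0"
    by (auto dest: DERIV_imp_deriv)
  then show ?thesis
    using f z
    by (intro Schwarz_Lemma_second_order[where u = "\<lambda>z. ?p z - z * deriv ?p z - 1"]
          holomorphic_intros hol hol')
       (auto simp: class_U_iff_z_over z_over_def[of f 0])
qed

section \<open>Dilations and averages\<close>

text \<open>Passing to the dilated function precomposes \<open>z / F\<close> and its defect with \<open>z \<mapsto> r z\<close>; the
  quadratic bound then yields the factor \<open>r\<^sup>2\<close>.\<close>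

lemma class_U_dilation:
  assumes F: "F \<in> class_U L" and r: "0 < r" "r \<le> 1" and le: "L * r\<^sup>2 \<le> l"
  shows "(\<lambda>z. inverse (of_real r) * F (of_real r * z)) \<in> class_U l"
    (is "?G \<in> _")
proof -
  let ?p = "z_over F"
  have hol: "?p holomorphic_on ball 0 1"
    using F by (simp add: class_U_iff_z_over)
  have L: "L > 0"
    using class_U_imp_pos[OF F] .
  have p: "z_over ?G = (\<lambda>z. ?p (of_real r * z))"
    using r by (auto simp: z_over_def field_simps)
  have norm_rz: "norm (of_real r * z) \<le> r * norm z" for z :: complex
    using r by (simp add: norm_mult)
  have in_ball: "of_real r * z \<in> ball 0 1" if "z \<in> ball 0 1" for z :: complex
    using that r mult_left_le_one_le[of "norm z" r] by (simp add: norm_mult)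
  have der: "((\<lambda>z. ?p (of_real r * z)) has_field_derivative
               deriv ?p (of_real r * z) * of_real r) (at z)" if "z \<in> ball 0 1" for z
    by (rule DERIV_chain2[where f = ?p and g = "\<lambda>z. of_real r * z"])
       (auto intro!: derivative_eq_intros holomorphic_derivI[OF hol open_ball in_ball[OF that]])
  have "norm (?p (of_real r * z) - z * (deriv ?p (of_real r * z) * of_real r) - 1) < l"
    if z: "z \<in> ball 0 1" for z
  proof -
    have "(norm z)\<^sup>2 < 1"
      using z by (simp add: power_less_one_iff)
    then have "L * (r\<^sup>2 * (norm z)\<^sup>2) < L * r\<^sup>2"
      using L r by simp
    moreover have "norm (?p (of_real r * z) - of_real r * z * deriv ?p (of_real r * z) - 1)
        \<le> L * (norm (of_real r * z))\<^sup>2"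
      by (rule class_U_defect_bound[OF F in_ball[OF z]])
    ultimately show ?thesis
      using le r by (simp add: norm_mult power_mult_distrib mult_ac)
  qed
  moreover have "(\<lambda>z. ?p (of_real r * z)) holomorphic_on ball 0 1"
    using der by (meson holomorphic_on_open open_ball)
  moreover have "?p (of_real r * z) \<noteq> 0" if "z \<in> ball 0 1" for z
    using F in_ball[OF that] by (simp add: class_U_iff_z_over)
  moreover have "?G 0 = 0"
    using F by (simp add: class_U_iff_z_over)
  ultimately show ?thesis
    unfolding class_U_iff_z_over p using DERIV_imp_deriv[OF der] by auto
qed

text \<open>The defect is affine in \<open>z / f\<close> and the weights \<open>1 / m\<close> add up to one, so the defect of
  \<open>F\<close> is the mean of the defects of the \<open>f k\<close>. The nonvanishing of the sum is what makes \<open>F\<close>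
  holomorphic, as \<open>F z\<close> is \<open>m z\<close> divided by that sum.\<close>

lemma class_U_mean:
  fixes m :: nat
  assumes m: "m \<ge> 1"
    and nz: "\<And>z. z \<in> ball 0 1 \<Longrightarrow> (\<Sum>k=1..m. z_over (f k) z) \<noteq> 0"
    and F0: "F 0 = 0"
    and F: "\<And>z. z \<in> ball 0 1 \<Longrightarrow> z_over F z = 1 / of_nat m * (\<Sum>k=1..m. z_over (f k) z)"
    and f: "\<And>k. k \<in> {1..m} \<Longrightarrow> f k \<in> class_U (lk k)"
  shows "F \<in> class_U ((\<Sum>k=1..m. lk k) / m)"
proof -
  have hol: "z_over (f k) holomorphic_on ball 0 1" if "k \<in> {1..m}" for k
    using f[OF that] by (simp add: class_U_iff_z_over)
  have der: "(z_over F has_field_derivative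
      1 / of_nat m * (\<Sum>k=1..m. deriv (z_over (f k)) z)) (at z)" if z: "z \<in> ball 0 1" for z
  proof (rule has_field_derivative_transform_within_open[OF _ open_ball z])
    show "((\<lambda>z. 1 / of_nat m * (\<Sum>k=1..m. z_over (f k) z)) has_field_derivative
        1 / of_nat m * (\<Sum>k=1..m. deriv (z_over (f k)) z)) (at z)"
      by (intro DERIV_cmult DERIV_sum holomorphic_derivI[OF hol open_ball z])
  qed (simp add: F)
  have "norm (z_over F z - z * deriv (z_over F) z - 1) < (\<Sum>k=1..m. lk k) / m"
    if z: "z \<in> ball 0 1" for z
  proof -
    let ?d = "\<lambda>k. z_over (f k) z - z * deriv (z_over (f k)) z - 1"
    have "z_over F z - z * deriv (z_over F) z - 1 = (\<Sum>k=1..m. ?d k) / of_nat m"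
      using m by (simp add: F[OF z] DERIV_imp_deriv[OF der[OF z]] sum_subtractf sum.distrib
            sum_distrib_left[symmetric] field_simps)
    moreover have "norm (\<Sum>k=1..m. ?d k) < (\<Sum>k=1..m. lk k)"
    proof -
      have "norm (\<Sum>k=1..m. ?d k) \<le> (\<Sum>k=1..m. norm (?d k))"
        by (rule norm_sum)
      also have "\<dots> < (\<Sum>k=1..m. lk k)"
        using m f z by (intro sum_strict_mono) (auto simp: class_U_iff_z_over)
      finally show ?thesis .
    qed
    ultimately show ?thesis
      using m by (simp add: norm_divide divide_strict_right_mono)
  qed
  moreover have "z_over F holomorphic_on ball 0 1"
    using der by (meson holomorphic_on_open open_ball)
  moreover have "z_over F z \<noteq> 0" if "z \<in> ball 0 1" for z
    using nz[OF that] m by (simp add: F[OF that])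
  ultimately show ?thesis
    unfolding class_U_iff_z_over using F0 by blast
qed

section \<open>Univalence\<close>

text \<open>The function \<open>g\<close> below is \<open>1 / f z - 1 / z\<close> with its removable singularity filled in. It is
  1-Lipschitz, whereas equal values of \<open>f\<close> at \<open>z \<noteq> w\<close> would make it stretch the distance by the
  factor \<open>1 / \<bar>z w\<bar> > 1\<close>.\<close>

lemma class_U_imp_inj_on:
  assumes f: "f \<in> class_U 1"
  shows "inj_on f (ball 0 1)"
proof -
  let ?p = "z_over f"
  have hol: "?p holomorphic_on ball 0 1" and f0: "f 0 = 0"
    and pnz: "\<And>z. z \<in> ball 0 1 \<Longrightarrow> ?p z \<noteq> 0"
    using f by (auto simp: class_U_iff_z_over)
  have fnz: "f z \<noteq> 0" if "z \<in> ball 0 1" "z \<noteq> 0" for z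
    using pnz[OF that(1)] that(2) by (auto simp: z_over_def)
  define g where "g = (\<lambda>z. if z = 0 then deriv ?p 0 else (?p z - ?p 0) / (z - 0))"
  have holg: "g holomorphic_on ball 0 1"
    unfolding g_def by (rule pole_lemma[OF hol]) simp
  have g: "g z = 1 / f z - 1 / z" if "z \<noteq> 0" for z
    using that by (simp add: g_def z_over_def diff_divide_distrib)
  have bound_off: "norm (deriv g z) \<le> 1" if z: "z \<in> ball 0 1" "z \<noteq> 0" for z
  proof -
    have "(g has_field_derivative - (?p z - z * deriv ?p z - 1) / z\<^sup>2) (at z)"
    proof (rule has_field_derivative_transform_within_open)
      show "((\<lambda>z. (?p z - 1) / z) has_field_derivative
              - (?p z - z * deriv ?p z - 1) / z\<^sup>2) (at z)"
        using holomorphic_derivI[OF hol open_ball z(1)] z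
        by (auto intro!: derivative_eq_intros simp: power2_eq_square algebra_simps)
      show "open (ball 0 1 - {0 :: complex})"
        by (intro open_delete open_ball)
    qed (use z in \<open>auto simp: g_def z_over_def\<close>)
    then have "norm (deriv g z) = norm (?p z - z * deriv ?p z - 1) / (norm z)\<^sup>2"
      by (simp add: DERIV_imp_deriv norm_divide norm_power norm_minus_commute)
    also have "\<dots> \<le> 1"
      using class_U_defect_bound[OF f z(1)] z by simp
    finally show ?thesis .
  qed
  \<comment> \<open>A segment between two points of the disc may pass through the origin, so the bound is
      needed there too; it follows by continuity.\<close>
  have bound: "norm (deriv g z) \<le> 1" if z: "z \<in> ball 0 1" for z
  proof (cases "z = 0")
    case True
    have "isCont (deriv g) 0"
      using holomorphic_on_imp_continuous_on[OF holomorphic_deriv[OF holg open_ball]]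
      by (rule continuous_on_interior) simp
    then have "(deriv g \<longlongrightarrow> deriv g 0) (at 0)"
      by (simp add: isCont_def)
    moreover have "eventually (\<lambda>z. norm (deriv g z) \<le> 1) (at 0)"
      unfolding eventually_at using bound_off by (intro exI[of _ 1]) auto
    ultimately have "norm (deriv g 0) \<le> 1"
      by (intro Lim_norm_ubound[of "at 0"]) auto
    then show ?thesis using True by simp
  qed (use bound_off z in auto)
  have lip: "norm (g z - g w) \<le> norm (z - w)" if "z \<in> ball 0 1" "w \<in> ball 0 1" for z w
    using field_differentiable_bound[of "ball 0 1" g "deriv g" 1 z w] that bound
      holomorphic_derivI[OF holg open_ball] by auto
  show ?thesis
  proof (rule inj_onI)
    fix z w :: complex
    assume z: "z \<in> ball 0 1" and w: "w \<in> ball 0 1" and eq: "f z = f w"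
    show "z = w"
    proof (cases "z = 0 \<or> w = 0")
      case True
      then show ?thesis using fnz f0 z w eq by metis
    next
      case False
      then have "g z - g w = (z - w) / (z * w)"
        using eq by (simp add: g field_simps)
      then have "norm (z - w) \<le> norm (z - w) * norm (z * w)"
        using lip[OF z w] False by (simp add: norm_divide norm_mult field_simps)
      moreover have "norm (z * w) < 1"
        using z w mult_strict_mono'[of "norm z" 1 "norm w" 1] by (simp add: norm_mult)
      ultimately show ?thesis
        by (metis eq_iff_diff_eq_0 linorder_not_less mult.right_neutral mult_strict_left_mono
            norm_eq_zero zero_less_norm_iff)
    qed
  qed
qed

section \<open>The radius\<close>

text \<open>The radius is the square root of the positive root of \<open>x\<^sup>2 + K\<^sup>2 x = K\<^sup>2\<close>, where
  \<open>K\<^sup>2 = l\<^sup>2 / L\<close>.\<close>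

lemma radius_bounds:
  fixes L l r K :: real
  assumes L: "0 < L" "L \<le> 1" and l: "0 < l" and K: "K = sqrt (l\<^sup>2 / L)"
    and r: "0 < r" "r \<le> sqrt ((- K\<^sup>2 + K * sqrt (K\<^sup>2 + 4)) / 2)"
  shows "r \<le> 1" and "L * r\<^sup>2 \<le> l"
proof -
  have K0: "K > 0" and K2: "L * K\<^sup>2 = l\<^sup>2"
    using L l by (auto simp: K)
  have "sqrt (r\<^sup>2) \<le> sqrt ((- K\<^sup>2 + K * sqrt (K\<^sup>2 + 4)) / 2)"
    using r by simp
  then have "r\<^sup>2 \<le> (- K\<^sup>2 + K * sqrt (K\<^sup>2 + 4)) / 2"
    by (simp only: real_sqrt_le_iff)
  then have "2 * r\<^sup>2 + K\<^sup>2 \<le> K * sqrt (K\<^sup>2 + 4)"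
    by simp
  then have "(2 * r\<^sup>2 + K\<^sup>2)\<^sup>2 \<le> (K * sqrt (K\<^sup>2 + 4))\<^sup>2"
    by (intro power_mono) auto
  also have "\<dots> = K\<^sup>2 * (K\<^sup>2 + 4)"
    by (simp add: power_mult_distrib)
  finally have quad: "(r\<^sup>2)\<^sup>2 \<le> K\<^sup>2 * (1 - r\<^sup>2)"
    by (simp add: power2_eq_square algebra_simps)
  then have "0 \<le> K\<^sup>2 * (1 - r\<^sup>2)"
    by (rule order_trans[rotated]) simp
  then have r2: "r\<^sup>2 \<le> 1"
    using K0 by (simp add: zero_le_mult_iff)
  then show "r \<le> 1"
    using r by (simp add: power_le_one_iff)
  have "(L * r\<^sup>2)\<^sup>2 = L\<^sup>2 * (r\<^sup>2)\<^sup>2"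
    by (simp add: power_mult_distrib)
  also have "\<dots> \<le> L\<^sup>2 * (K\<^sup>2 * (1 - r\<^sup>2))"
    using quad by (intro mult_left_mono) auto
  also have "\<dots> = l\<^sup>2 * (L * (1 - r\<^sup>2))"
    using K2 by (simp add: power2_eq_square algebra_simps)
  also have "\<dots> \<le> l\<^sup>2 * 1"
    using L r2 by (intro mult_left_mono mult_le_one) auto
  finally show "L * r\<^sup>2 \<le> l"
    using l by (auto intro: power2_le_imp_le)
qed

theorem theorem4:
  fixes m :: nat
    and f :: "nat \<Rightarrow> complex \<Rightarrow> complex"
    and F :: "complex \<Rightarrow> complex"
  assumes "m \<ge> 1"
    and "\<forall>z\<in>ball 0 1. (\<Sum>k=1..m. z_over (f k) z) \<noteq> 0"
    and "F 0 = 0"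
    and "\<forall>z\<in>ball 0 1. z_over F z = 1 / of_nat m * (\<Sum>k=1..m. z_over (f k) z)"
  shows "(\<forall>(l::real) (lk :: nat \<Rightarrow> real) (r::real) (K::real).
            l \<in> {0<..1} \<longrightarrow>
            (\<forall>k\<in>{1..m}. lk k \<in> {0<..1} \<and> f k \<in> class_U (lk k)) \<longrightarrow>
            K = sqrt (real m * l\<^sup>2 / (\<Sum>k=1..m. lk k)) \<longrightarrow>
            0 < r \<longrightarrow> r \<le> sqrt ((- K\<^sup>2 + K * sqrt (K\<^sup>2 + 4)) / 2) \<longrightarrow>
            (\<lambda>z. inverse (of_real r) * F (of_real r * z)) \<in> class_U l)
       \<and> ((\<forall>k\<in>{1..m}. f k \<in> class_U 1) \<longrightarrow>
            (\<forall>r::real. 0 < r \<longrightarrow> r \<le> sqrt ((sqrt 5 - 1) / 2) \<longrightarrow>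
               (\<lambda>z. inverse (of_real r) * F (of_real r * z)) \<in> class_U 1)
            \<and> inj_on F (ball 0 (sqrt ((sqrt 5 - 1) / 2))))"
proof -
  have mean: "F \<in> class_U ((\<Sum>k=1..m. lk k) / m)"
    if "\<forall>k\<in>{1..m}. f k \<in> class_U (lk k)" for lk :: "nat \<Rightarrow> real"
    using assms that by (intro class_U_mean[where f = f]) auto
  have general: "(\<lambda>z. inverse (of_real r) * F (of_real r * z)) \<in> class_U l"
    if l: "l \<in> {0<..1}"
      and f: "\<forall>k\<in>{1..m}. lk k \<in> {0<..1} \<and> f k \<in> class_U (lk k)"
      and K: "K = sqrt (real m * l\<^sup>2 / (\<Sum>k=1..m. lk k))"
      and r: "0 < r" "r \<le> sqrt ((- K\<^sup>2 + K * sqrt (K\<^sup>2 + 4)) / 2)"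
    for l r K :: real and lk :: "nat \<Rightarrow> real"
  proof -
    let ?L = "(\<Sum>k=1..m. lk k) / m"
    have F: "F \<in> class_U ?L"
      using f by (intro mean) auto
    have "(\<Sum>k=1..m. lk k) \<le> m"
      using sum_bounded_above[of "{1..m}" lk 1] f by auto
    then have L: "?L \<le> 1"
      using \<open>m \<ge> 1\<close> by simp
    have K': "K = sqrt (l\<^sup>2 / ?L)"
      by (simp add: K mult.commute)
    show ?thesis
      using radius_bounds[OF class_U_imp_pos[OF F] L _ K' r] l r
      by (intro class_U_dilation[OF F]) auto
  qed
  have special: "(\<lambda>z. inverse (of_real r) * F (of_real r * z)) \<in> class_U 1"
    if "\<forall>k\<in>{1..m}. f k \<in> class_U 1" "0 < r" "r \<le> sqrt ((sqrt 5 - 1) / 2)" for r :: real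
    using that \<open>m \<ge> 1\<close> by (intro general[of 1 "\<lambda>_. 1" 1 r]) auto
  have "inj_on F (ball 0 (sqrt ((sqrt 5 - 1) / 2)))"
    if "\<forall>k\<in>{1..m}. f k \<in> class_U 1"
  proof -
    have "F \<in> class_U 1"
      using mean[of "\<lambda>_. 1"] that \<open>m \<ge> 1\<close> by simp
    then have "inj_on F (ball 0 1)"
      by (rule class_U_imp_inj_on)
    moreover have "sqrt 5 \<le> 3"
      by (rule real_le_lsqrt) auto
    then have "sqrt ((sqrt 5 - 1) / 2) \<le> 1"
      by simp
    then have "ball 0 (sqrt ((sqrt 5 - 1) / 2)) \<subseteq> (ball 0 1 :: complex set)"
      by (rule subset_ball)
    ultimately show ?thesis
      by (rule inj_on_subset)
  qed
  with general special show ?thesis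
    by blast
qed

end
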